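(* Let $u\ge \ell\ge 1$ and $m\ge 1$ be integers, let $n\coloneqq 2^\ell$, let $S\subset\mathbb{F}_2^u$ be a set of cardinality $m$, and let $\mathcal{H}$ be the set of all linear maps $\mathbb{F}_2^u\to\mathbb{F}_2^\ell$. For every $0<\varepsilon<1/2$ there exist constants $C_1<C_2$, depending only on $\varepsilon$, such that if $m\ge C_1^{-1} n\log n$, then for $h$ drawn uniformly at random from $\mathcal{H}$, \[\Pr_{h\sim \mathcal{H}}\left[\forall y\in \mathbb{F}_2^\ell,~ C_1 \frac{m}{n}\le |h^{-1}(y)\cap S|\le C_2 \frac{m}{n}\right] \ge 1-\varepsilon.\] Moreover, one can take $C_1 = \Omega(\varepsilon^{74})$ and $C_2 = O(\varepsilon^{-1/2})$.
   Context: $\log$ denotes the base-2 logarithm. *)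

theory Defs
  imports
    "HOL-Probability.Probability"
    "HOL-Library.Landau_Symbols"
    "HOL-Library.Z2"
    "Jordan_Normal_Form.VS_Connect"
begin

(* The spaces are carriers rather than types, so that u and l can be quantified inside a formula.
   Maps are made extensional so that each linear map is represented by exactly one HOL function;
   otherwise the values outside F_2^u would be arbitrary and the set infinite. *)
definition linear_maps_F2 :: "nat \<Rightarrow> nat \<Rightarrow> (bit vec \<Rightarrow> bit vec) set" where
  "linear_maps_F2 u l =
     LinearCombinations.module_hom (class_ring :: bit ring)
       (module_vec TYPE(bit) u) (module_vec TYPE(bit) l)
     \<inter> extensional (carrier_vec u)"

end

theory Submission
  imports Defs
begin

text \<open>
  A uniform linear map \<open>h\<close> to \<open>w\<close> bits arises from a uniform linear map \<open>T\<close> to \<open>w + 1\<close> bits by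
  dividing out a vector \<open>(v, 1)\<close> with \<open>v\<close> uniform, which merges the bins in pairs. Let \<open>P\<close> be the
  average over all bins of \<open>c\<close> to the power of the load. As the two halves of the bins of \<open>T\<close> are
  shifted against each other by a uniform \<open>v\<close>, the conditional mean of \<open>P(h)\<close> given \<open>T\<close> is at most
  \<open>P(T)\<^sup>2\<close>.

  Lower bound (\<open>c = 1/2\<close>): by Jensen the mean of \<open>P\<close> to the power \<open>1/2\<^sup>k\<close> at level \<open>l\<close> is at most
  the mean of \<open>P\<close> at level \<open>l + k\<close>. Choose \<open>k\<close> so that the average load there is of order \<open>1/\<epsilon>\<close>; then
  pairwise independence bounds this mean by \<open>O(\<epsilon>)\<close>.

  Upper bound (\<open>c = 2\<close>): start at a level so high that \<open>h\<close> is almost surely injective on \<open>S\<close>, and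
  follow a suitable supermartingale in \<open>P\<close> down to level \<open>l\<close>. It yields
  \<open>ln P \<le> O(r m / n)\<close> except with probability \<open>1 / r\<^sup>2\<close>.

  In both cases \<open>n P\<close> bounds \<open>c\<close> to the power of every single load.
\<close>

text \<open>Bit arithmetic stays in field notation, so that the usual algebraic rewriting
  applies.\<close>

declare add_bit_eq_xor [simp del] mult_bit_eq_and [simp del]

section \<open>Averages over finite sets\<close>

definition mean :: "('a \<Rightarrow> real) \<Rightarrow> 'a set \<Rightarrow> real" where
  "mean F X = (\<Sum>x\<in>X. F x) / real (card X)"

lemma mean_mono:
  assumes "\<And>x. x \<in> X \<Longrightarrow> F x \<le> G x"
  shows "mean F X \<le> mean G X"
  unfolding mean_def using assms by (intro divide_right_mono sum_mono) auto

lemma mean_cong: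
  assumes "\<And>x. x \<in> X \<Longrightarrow> F x = G x"
  shows "mean F X = mean G X"
  unfolding mean_def using assms by simp

lemma mean_const:
  assumes "finite X" "X \<noteq> {}"
  shows "mean (\<lambda>_. c) X = c"
  unfolding mean_def using assms by simp

lemma mean_add: "mean (\<lambda>x. F x + G x) X = mean F X + mean G X"
  unfolding mean_def by (simp add: sum.distrib add_divide_distrib)

lemma mean_cmult: "mean (\<lambda>x. c * F x) X = c * mean F X"
  unfolding mean_def by (simp add: sum_distrib_left)

lemma mean_affine:
  assumes "finite X" "X \<noteq> {}"
  shows "mean (\<lambda>x. c + d * F x) X = c + d * mean F X"
  using assms by (simp add: mean_add mean_cmult mean_const)

lemma mean_sum: "mean (\<lambda>x. \<Sum>i\<in>I. F i x) X = (\<Sum>i\<in>I. mean (F i) X)"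
  unfolding mean_def by (subst sum.swap) (simp add: sum_divide_distrib)

lemma mean_swap: "mean (\<lambda>x. mean (\<lambda>y. F x y) Y) X = mean (\<lambda>y. mean (\<lambda>x. F x y) X) Y"
  unfolding mean_def by (simp add: sum_divide_distrib[symmetric] sum.swap[of F] mult.commute)

lemma mean_markov:
  assumes "finite X" "\<And>x. x \<in> X \<Longrightarrow> 0 \<le> F x"
    and "\<And>x. x \<in> B \<Longrightarrow> 1 \<le> F x" "B \<subseteq> X"
  shows "real (card B) / real (card X) \<le> mean F X"
proof -
  have "real (card B) = (\<Sum>x\<in>B. 1)" by simp
  also have "\<dots> \<le> (\<Sum>x\<in>B. F x)" using assms(3) by (intro sum_mono) auto
  also have "\<dots> \<le> (\<Sum>x\<in>X. F x)" using assms by (intro sum_mono2) auto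
  finally show ?thesis unfolding mean_def by (rule divide_right_mono) simp
qed

section \<open>Real inequalities\<close>

text \<open>Concavity of the power function, in tangent form at \<open>q\<close>; it stands in for
  Jensen's inequality in the lower tail. The source is convexity of \<open>exp\<close> between 0 and
  \<open>ln (x / q)\<close>.\<close>

lemma powr_le_tangent:
  fixes x q \<theta> :: real
  assumes "x > 0" "q > 0" "0 \<le> \<theta>" "\<theta> \<le> 1"
  shows "x powr \<theta> \<le> q powr \<theta> + \<theta> * q powr \<theta> / q * (x - q)"
proof -
  have "exp ((1 - \<theta>) *\<^sub>R 0 + \<theta> *\<^sub>R ln (x / q)) \<le> (1 - \<theta>) * exp 0 + \<theta> * exp (ln (x / q))"
    using assms by (intro convex_onD[OF exp_convex]) auto
  then have "(x / q) powr \<theta> \<le> 1 + \<theta> * (x / q - 1)"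
    using assms by (simp add: powr_def algebra_simps)
  then have "q powr \<theta> * (x / q) powr \<theta> \<le> q powr \<theta> * (1 + \<theta> * (x / q - 1))"
    by (intro mult_left_mono) auto
  moreover have "q powr \<theta> * (x / q) powr \<theta> = x powr \<theta>"
    using assms by (simp add: powr_mult[symmetric])
  moreover have "q powr \<theta> * (1 + \<theta> * (x / q - 1)) = q powr \<theta> + \<theta> * q powr \<theta> / q * (x - q)"
    using assms by (simp add: field_simps)
  ultimately show ?thesis by simp
qed

text \<open>A load below half of \<mu> makes the quadratic term at least 1, as in Chebyshev's
  inequality; a larger load \<open>f\<close> has 2^-f at most 1/f. Second moments thereby control
  the mean of 2^-load.\<close>

lemma half_power_le_quadratic:
  fixes \<mu> :: real
  assumes "\<mu> > 0"
  shows "(1 / 2) ^ f \<le> 4 / \<mu>\<^sup>2 * (real f - \<mu>)\<^sup>2 + 2 / \<mu>"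
proof (cases "real f \<le> \<mu> / 2")
  case True
  have "(\<mu> / 2)\<^sup>2 \<le> (\<mu> - real f)\<^sup>2" using True assms by (intro power_mono) auto
  then have "1 \<le> 4 / \<mu>\<^sup>2 * (real f - \<mu>)\<^sup>2"
    using assms by (simp add: field_simps power2_commute[of \<mu>])
  moreover have "(1 / 2 :: real) ^ f \<le> 1" by (simp add: power_le_one)
  moreover have "0 \<le> 2 / \<mu>" using assms by simp
  ultimately show ?thesis by linarith
next
  case False
  then have f: "real f > \<mu> / 2" "real f > 0" using assms by auto
  have "real f \<le> 2 ^ f" using of_nat_less_two_power[of f, where 'a = real] by linarith
  then have "(1 / 2) ^ f \<le> 1 / real f" using f by (simp add: field_simps power_one_over)
  also have "\<dots> \<le> 2 / \<mu>" using f assms by (simp add: field_simps)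
  also have "\<dots> \<le> 4 / \<mu>\<^sup>2 * (real f - \<mu>)\<^sup>2 + 2 / \<mu>" by simp
  finally show ?thesis .
qed

section \<open>The barrier supermartingale in one real variable\<close>

text \<open>An upper bound for the probability that a quantity which starts at \<open>1 + a\<close>, and whose
  conditional mean at each step is at most its square, ever outgrows \<open>exp (O(t))\<close>, where \<open>t\<close>
  doubles at each step. The bound is of order \<open>(a / t)\<^sup>2\<close> for small \<open>a\<close>, but
  grows only linearly in \<open>a\<close> beyond \<open>t\<close>, so that it can be controlled by first moments.\<close>

definition barrier :: "real \<Rightarrow> real \<Rightarrow> real" where
  "barrier t a = min 1 ((1 + t) * exp (- 4 * t) * (a\<^sup>2 / (t * (t + a))))"

text \<open>The quotient equals p - d + d^2/(d+p), whose last term decreases in p, so it grows with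
  slope at most 1. This makes the barrier affine in \<open>p\<close> beyond a known lower
  bound.\<close>

lemma quotient_le_chord:
  fixes d a p :: real
  assumes "d > 0" "0 \<le> a" "a \<le> p"
  shows "p\<^sup>2 / (d + p) \<le> a\<^sup>2 / (d + a) + (p - a)"
proof -
  have "d\<^sup>2 / (d + p) \<le> d\<^sup>2 / (d + a)" using assms by (intro divide_left_mono) auto
  moreover have "p\<^sup>2 / (d + p) = p - d + d\<^sup>2 / (d + p)" "a\<^sup>2 / (d + a) = a - d + d\<^sup>2 / (d + a)"
    using assms by (auto simp: field_simps power2_eq_square)
  ultimately show ?thesis by simp
qed

text \<open>Below 1 the minimum is attained by its second argument, and a^2/(t+a) is at least a -
  t.\<close>

lemma barrier_less_1_bound:
  assumes "t > 0" "a \<ge> 0" "barrier t a < 1"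
  shows "(1 + t) * (a - t) \<le> t * exp (4 * t)"
proof -
  have "(1 + t) * exp (- 4 * t) * (a\<^sup>2 / (t * (t + a))) < 1"
    using assms(3) by (simp add: barrier_def)
  moreover have "(1 + t) * (a\<^sup>2 / (t + a))
      = (1 + t) * exp (- 4 * t) * (a\<^sup>2 / (t * (t + a))) * (t * exp (4 * t))"
    using assms by (simp add: exp_minus divide_simps)
  ultimately have "(1 + t) * (a\<^sup>2 / (t + a)) < 1 * (t * exp (4 * t))"
    using assms by (metis mult_strict_right_mono mult_pos_pos exp_gt_zero)
  moreover have "(a - t) \<le> a\<^sup>2 / (t + a)"
    using assms by (simp add: field_simps power2_eq_square)
  then have "(1 + t) * (a - t) \<le> (1 + t) * (a\<^sup>2 / (t + a))"
    using assms by (intro mult_left_mono) auto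
  ultimately show ?thesis by linarith
qed

lemma barrier_less_1_imp_le_exp:
  assumes "t > 0" "a \<ge> 0" "barrier t a < 1"
  shows "1 + a \<le> exp (5 * t)"
proof -
  have "a - t \<le> (1 + t) * (a - t) \<or> a \<le> t" using assms by (auto simp: mult_le_cancel_right1)
  then have "a - t \<le> t * exp (4 * t)" using barrier_less_1_bound[OF assms] assms(1)
    by (smt (verit) mult_pos_pos exp_gt_zero)
  moreover have "1 + t \<le> exp (4 * t)" using exp_ge_add_one_self[of "4 * t"] assms(1) by linarith
  ultimately have "1 + a \<le> exp (4 * t) * (1 + t)" by (simp add: algebra_simps)
  also have "\<dots> \<le> exp (4 * t) * exp t" by (intro mult_left_mono exp_ge_add_one_self) auto
  finally show ?thesis by (simp add: exp_add[symmetric])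
qed

lemma barrier_nonneg: "t > 0 \<Longrightarrow> a \<ge> 0 \<Longrightarrow> barrier t a \<ge> 0"
  by (simp add: barrier_def)

lemma barrier_le_1: "barrier t a \<le> 1"
  by (simp add: barrier_def)

text \<open>The prefactor is at most 1. This bounds the starting value of the supermartingale, where
  \<open>a\<close> is small compared with \<open>t\<close>.\<close>

lemma barrier_le_square:
  assumes "t > 0" "a \<ge> 0"
  shows "barrier t a \<le> (a / t)\<^sup>2"
proof -
  have "1 + t \<le> exp (4 * t)" using exp_ge_add_one_self[of "4 * t"] assms(1) by linarith
  then have "(1 + t) * exp (- 4 * t) \<le> 1" by (simp add: exp_minus field_simps)
  moreover have "a\<^sup>2 / (t * (t + a)) \<le> (a / t)\<^sup>2"
    using assms by (simp add: power_divide power2_eq_square frac_le)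
  ultimately have "(1 + t) * exp (- 4 * t) * (a\<^sup>2 / (t * (t + a))) \<le> 1 * (a / t)\<^sup>2"
    using assms by (intro mult_mono) auto
  then show ?thesis by (simp add: barrier_def)
qed

text \<open>Here 1 + a is the potential before a merge and 1 + p after it; the mean bound is (1+a)^2
  - 1. Where the barrier is already 1 nothing is to be shown. Otherwise
  \<open>barrier (2 * t)\<close> lies below an affine function of \<open>p\<close>, whose mean needs
  only the mean of \<open>p\<close>.\<close>

lemma mean_barrier_le:
  assumes X: "finite X" "X \<noteq> {}" and t: "t > 0" and a: "a \<ge> 0"
    and p: "\<And>x. x \<in> X \<Longrightarrow> 2 * a \<le> p x" and mean_p: "mean p X \<le> 2 * a + a\<^sup>2"
  shows "mean (\<lambda>x. barrier (2 * t) (p x)) X \<le> barrier t a"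
proof (cases "barrier t a < 1")
  case False
  then have "barrier t a = 1" using barrier_le_1[of t a] by linarith
  then show ?thesis using mean_mono[of X _ "\<lambda>_. 1"] barrier_le_1 mean_const[OF X, of 1] by metis
next
  case True
  define E where "E = exp (4 * t)"
  \<comment> \<open>The coefficient of p^2/(2t+p) in \<open>barrier (2 * t) p\<close>.\<close>
  define c where "c = (1 + 2 * t) / (2 * t * E\<^sup>2)"
  have E: "E > 0" and c: "c > 0" using t by (auto simp: E_def c_def)
  have E2: "exp (- (8 * t)) = 1 / E\<^sup>2" and E1: "exp (- 4 * t) = 1 / E"
    by (simp_all add: E_def power2_eq_square exp_add[symmetric] exp_minus field_simps)
  have "barrier (2 * t) (p x) \<le> c * (2 * a\<^sup>2 / (t + a) - 2 * a) + c * p x" if "x \<in> X" for x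
  proof -
    have "barrier (2 * t) (p x) \<le> c * ((p x)\<^sup>2 / (2 * t + p x))"
      using E2 unfolding barrier_def c_def
      by (intro order_trans[OF min.cobounded2]) (simp add: mult.left_commute[of "E\<^sup>2"] mult.assoc)
    also have "\<dots> \<le> c * ((2 * a)\<^sup>2 / (2 * t + 2 * a) + (p x - 2 * a))"
      using c t a p[OF that] by (intro mult_left_mono quotient_le_chord) auto
    also have "(2 * a)\<^sup>2 / (2 * t + 2 * a) = 2 * a\<^sup>2 / (t + a)"
      using t a by (simp add: field_simps power2_eq_square)
    finally show ?thesis by (simp add: algebra_simps)
  qed
  then have "mean (\<lambda>x. barrier (2 * t) (p x)) X
      \<le> mean (\<lambda>x. c * (2 * a\<^sup>2 / (t + a) - 2 * a) + c * p x) X" by (rule mean_mono)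
  also have "\<dots> = c * (2 * a\<^sup>2 / (t + a) - 2 * a) + c * mean p X" by (rule mean_affine[OF X])
  also have "\<dots> \<le> c * (2 * a\<^sup>2 / (t + a) - 2 * a) + c * (2 * a + a\<^sup>2)"
    using mean_p c by (intro add_left_mono mult_left_mono) auto
  also have "\<dots> = c * (2 * a\<^sup>2 / (t + a) + a\<^sup>2)" by (simp add: algebra_simps)
  also have "\<dots> = (1 + 2 * t) * (2 + t + a) * (a\<^sup>2 / (2 * t * E\<^sup>2 * (t + a)))"
    using t a E by (simp add: c_def field_simps)
  also have "\<dots> \<le> 2 * (1 + t) * E * (a\<^sup>2 / (2 * t * E\<^sup>2 * (t + a)))"
  \<comment> \<open>Multiplying by 1 + t and writing 2 + t + a = 2(1+t) + (a-t) isolates the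
    quantity bounded by \<open>a_le\<close>. What remains has coefficient 2(1+t)^2 - (1+2t)t = 2 +
    3t on \<open>E\<close>, and the quadratic Taylor bound for \<open>E\<close> suffices.\<close>
  proof (rule mult_right_mono)
    have a_le: "(1 + t) * (a - t) \<le> t * E"
      using barrier_less_1_bound[OF t a True] by (simp add: E_def)
    have "1 + 4 * t + 8 * t\<^sup>2 \<le> E"
      using exp_lower_Taylor_quadratic[of "4 * t"] t by (simp add: E_def power2_eq_square)
    then have "(2 + 3 * t) * (1 + 4 * t + 8 * t\<^sup>2) \<le> (2 + 3 * t) * E"
      using t by (intro mult_left_mono) auto
    moreover have "2 * (1 + 2 * t) * (1 + t)\<^sup>2 \<le> (2 + 3 * t) * (1 + 4 * t + 8 * t\<^sup>2)"
      using t by (simp add: algebra_simps power2_eq_square)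
    ultimately have "2 * (1 + 2 * t) * (1 + t)\<^sup>2 + (1 + 2 * t) * (t * E) \<le> 2 * (1 + t)\<^sup>2 * E"
      by (simp add: algebra_simps power2_eq_square)
    moreover have "(1 + 2 * t) * ((1 + t) * (a - t)) \<le> (1 + 2 * t) * (t * E)"
      using a_le t by (intro mult_left_mono) auto
    ultimately have "(1 + t) * ((1 + 2 * t) * (2 + t + a)) \<le> (1 + t) * (2 * (1 + t) * E)"
      by (simp add: algebra_simps power2_eq_square)
    then show "(1 + 2 * t) * (2 + t + a) \<le> 2 * (1 + t) * E" using t by simp
  qed (use t a E in simp)
  also have "\<dots> = (1 + t) * exp (- 4 * t) * (a\<^sup>2 / (t * (t + a)))"
    unfolding E1 using t a E by (simp add: divide_simps power2_eq_square) (simp add: algebra_simps)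
  also have "\<dots> = barrier t a" using True by (simp add: barrier_def)
  finally show ?thesis .
qed

section \<open>Labels and systems of functionals\<close>

lemma UNIV_bit: "(UNIV :: bit set) = {0, 1}"
  by (metis (full_types) UNIV_eq_I bit_not_one_iff insertI1 insertI2)

lemma bit_add_self: "(b :: bit) + b = 0"
  by (cases b) simp_all

lemma bit_add_self_left: "(b :: bit) + (b + c) = c"
  by (simp add: add.assoc[symmetric] bit_add_self)

text \<open>Bins are zero-padded bit sequences, so that labels of all lengths share one type and
  \<open>y(w := b)\<close> appends a bit.\<close>

definition labels :: "nat \<Rightarrow> (nat \<Rightarrow> bit) set" where
  "labels w = {y. \<forall>i\<ge>w. y i = 0}"

lemma labels_0: "labels 0 = {\<lambda>_. 0}"
  by (auto simp: labels_def)

lemma bij_betw_labels_Suc: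
  "bij_betw (\<lambda>(b, y). y(w := b)) (UNIV \<times> labels w) (labels (Suc w))"
  by (rule bij_betw_byWitness[where f' = "\<lambda>y. (y w, y(w := 0))"])
     (auto simp: labels_def fun_eq_iff Suc_le_eq)

lemma finite_labels: "finite (labels w)"
proof (induction w)
  case (Suc w)
  have "finite ((UNIV :: bit set) \<times> labels w)" using Suc by (simp add: UNIV_bit)
  then show ?case using bij_betw_finite[OF bij_betw_labels_Suc[of w]] by blast
qed (simp add: labels_0)

lemma sum_labels_Suc:
  fixes F :: "_ \<Rightarrow> real"
  shows "(\<Sum>y\<in>labels (Suc w). F y) = (\<Sum>y\<in>labels w. F (y(w := 0))) + (\<Sum>y\<in>labels w. F (y(w := 1)))"
proof -
  have "(\<Sum>y\<in>labels (Suc w). F y) = (\<Sum>p\<in>UNIV \<times> labels w. F ((snd p)(w := fst p)))"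
    using sum.reindex_bij_betw[OF bij_betw_labels_Suc[of w], of F] by (simp add: case_prod_unfold)
  also have "\<dots> = (\<Sum>b\<in>UNIV. \<Sum>y\<in>labels w. F (y(w := b)))"
    by (simp add: sum.cartesian_product case_prod_unfold)
  finally show ?thesis by (simp add: UNIV_bit)
qed

lemma card_labels: "card (labels w) = 2 ^ w"
proof (induction w)
  case (Suc w)
  have "card (labels (Suc w)) = card ((UNIV :: bit set) \<times> labels w)"
    using bij_betw_same_card[OF bij_betw_labels_Suc[of w]] by simp
  then show ?case using Suc by (simp add: card_cartesian_product UNIV_bit)
qed (simp add: labels_0)

lemma labels_nonempty: "labels w \<noteq> {}"
  by (auto simp: labels_def)

lemma bij_betw_labels_add:
  assumes "v \<in> labels w"
  shows "bij_betw (\<lambda>y i. v i + y i) (labels w) (labels w)"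
  by (rule bij_betw_byWitness[where f' = "\<lambda>y i. v i + y i"])
     (use assms in \<open>auto simp: labels_def bit_add_self_left\<close>)

lemma mean_labels_Suc:
  "mean F (labels (Suc w)) = (mean (\<lambda>y. F (y(w := 0))) (labels w) + mean (\<lambda>y. F (y(w := 1))) (labels w)) / 2"
  by (simp add: mean_def card_labels sum_labels_Suc field_simps)

lemma mean_labels_shift:
  assumes "v \<in> labels w"
  shows "mean (\<lambda>y. F (\<lambda>i. v i + y i)) (labels w) = mean F (labels w)"
  unfolding mean_def using sum.reindex_bij_betw[OF bij_betw_labels_add[OF assms], of F] by simp

text \<open>For fixed \<open>y\<close> the label y + v is uniform when \<open>v\<close> is, so
  averaging over \<open>v\<close> first decouples the factors.\<close>

lemma mean_labels_convolution:
  "mean (\<lambda>v. mean (\<lambda>y. F y * G (\<lambda>i. y i + v i)) (labels w)) (labels w)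
    = mean F (labels w) * mean G (labels w)"
proof -
  have "mean (\<lambda>v. mean (\<lambda>y. F y * G (\<lambda>i. y i + v i)) (labels w)) (labels w)
      = mean (\<lambda>y. mean (\<lambda>v. F y * G (\<lambda>i. y i + v i)) (labels w)) (labels w)"
    by (rule mean_swap)
  also have "\<dots> = mean (\<lambda>y. mean G (labels w) * F y) (labels w)"
    by (rule mean_cong) (simp add: mean_cmult mean_labels_shift mult.commute[of "mean G _"])
  also have "\<dots> = mean G (labels w) * mean F (labels w)" by (rule mean_cmult)
  finally show ?thesis by (simp only: mult.commute)
qed

section \<open>Loads, potentials and random tuples of functionals\<close>

definition load :: "'a set \<Rightarrow> ('a \<Rightarrow> nat \<Rightarrow> bit) \<Rightarrow> (nat \<Rightarrow> bit) \<Rightarrow> nat" where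
  "load S h y = card {x \<in> S. h x = y}"

text \<open>The quantity P of the overview: a normalised generating function of the loads.\<close>

definition potential :: "real \<Rightarrow> 'a set \<Rightarrow> nat \<Rightarrow> ('a \<Rightarrow> nat \<Rightarrow> bit) \<Rightarrow> real" where
  "potential c S w h = mean (\<lambda>y. c ^ load S h y) (labels w)"

text \<open>\<open>D\<close> plays the role of the dual space; over two scalars, closure under
  addition makes it a subspace. Separation of points is what yields pairwise independence.\<close>

locale functional_system =
  fixes D :: "('a \<Rightarrow> bit) set" and S :: "'a set"
  assumes finite_D: "finite D"
    and zero_D: "(\<lambda>_. 0) \<in> D"
    and add_D: "r \<in> D \<Longrightarrow> s \<in> D \<Longrightarrow> (\<lambda>x. r x + s x) \<in> D"
    and finite_S: "finite S"
    and separating: "x \<in> S \<Longrightarrow> y \<in> S \<Longrightarrow> x \<noteq> y \<Longrightarrow> \<exists>r\<in>D. r x \<noteq> r y"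
begin

text \<open>A uniform element consists of \<open>w\<close> independent uniform functionals, its
  coordinates; the padding by zeros matches \<open>labels\<close>.\<close>

definition maps :: "nat \<Rightarrow> ('a \<Rightarrow> nat \<Rightarrow> bit) set" where
  "maps w = {h. (\<forall>i<w. (\<lambda>x. h x i) \<in> D) \<and> (\<forall>x. \<forall>i\<ge>w. h x i = 0)}"

definition extend :: "nat \<Rightarrow> ('a \<Rightarrow> nat \<Rightarrow> bit) \<Rightarrow> ('a \<Rightarrow> bit) \<Rightarrow> 'a \<Rightarrow> nat \<Rightarrow> bit" where
  "extend w h r = (\<lambda>x. (h x)(w := r x))"

definition twist :: "('a \<Rightarrow> nat \<Rightarrow> bit) \<Rightarrow> ('a \<Rightarrow> bit) \<Rightarrow> (nat \<Rightarrow> bit) \<Rightarrow> 'a \<Rightarrow> nat \<Rightarrow> bit" where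
  "twist h r v = (\<lambda>x i. h x i + r x * v i)"

lemma maps_label: "h \<in> maps w \<Longrightarrow> h x \<in> labels w"
  by (auto simp: maps_def labels_def)

lemma maps_0: "maps 0 = {\<lambda>_ _. 0}"
  by (auto simp: maps_def)

lemma bij_betw_extend: "bij_betw (\<lambda>(r, h). extend w h r) (D \<times> maps w) (maps (Suc w))"
proof (rule bij_betw_byWitness[where f' = "\<lambda>h. (\<lambda>x. h x w, \<lambda>x. (h x)(w := 0))"])
  show "(\<lambda>h. (\<lambda>x. h x w, \<lambda>x. (h x)(w := 0))) ` maps (Suc w) \<subseteq> D \<times> maps w"
    by (auto simp: maps_def less_Suc_eq Suc_le_eq)
qed (auto simp: maps_def extend_def fun_eq_iff Suc_le_eq less_Suc_eq)

lemma finite_maps: "finite (maps w)"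
proof (induction w)
  case (Suc w)
  have "finite (D \<times> maps w)" using Suc finite_D by simp
  then show ?case using bij_betw_finite[OF bij_betw_extend[of w]] by blast
qed (simp add: maps_0)

lemma maps_nonempty: "maps w \<noteq> {}"
  using zero_D by (auto simp: maps_def intro!: exI[of _ "\<lambda>_ _. 0"])

lemma card_D_pos: "card D > 0"
  using finite_D zero_D by (auto simp: card_gt_0_iff)

lemma card_maps_pos: "card (maps w) > 0"
  using finite_maps maps_nonempty by (auto simp: card_gt_0_iff)

lemma card_maps_Suc: "card (maps (Suc w)) = card D * card (maps w)"
  using bij_betw_same_card[OF bij_betw_extend[of w]] by (simp add: card_cartesian_product)

lemma mean_maps_Suc: "mean F (maps (Suc w)) = mean (\<lambda>r. mean (\<lambda>h. F (extend w h r)) (maps w)) D"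
proof -
  have "(\<Sum>h\<in>maps (Suc w). F h) = (\<Sum>p\<in>D \<times> maps w. F (extend w (snd p) (fst p)))"
    using sum.reindex_bij_betw[OF bij_betw_extend[of w], of F] by (simp add: case_prod_unfold)
  also have "\<dots> = (\<Sum>r\<in>D. \<Sum>h\<in>maps w. F (extend w h r))"
    by (simp add: sum.cartesian_product case_prod_unfold)
  finally show ?thesis
    by (simp add: mean_def card_maps_Suc sum_divide_distrib[symmetric] mult.commute)
qed

section \<open>Rank-one twists and the merging of bins\<close>

lemma twist_in_maps:
  assumes "h \<in> maps w" "r \<in> D" "v \<in> labels w"
  shows "twist h r v \<in> maps w"
proof -
  have "(\<lambda>x. h x i + r x * v i) \<in> D" if "i < w" for i
  proof (cases "v i = 0")
    case True
    then show ?thesis using assms(1) that by (simp add: maps_def)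
  next
    case False
    then have "v i = 1" by simp
    then show ?thesis using assms(1,2) that add_D by (simp add: maps_def)
  qed
  then show ?thesis using assms(1,3) by (simp add: maps_def twist_def labels_def)
qed

lemma twist_twist: "twist (twist h r v) r v = h"
  by (simp add: twist_def fun_eq_iff add.assoc bit_add_self)

lemma mean_maps_twist:
  assumes "r \<in> D" "v \<in> labels w"
  shows "mean (\<lambda>h. F (twist h r v)) (maps w) = mean F (maps w)"
proof -
  have "bij_betw (\<lambda>h. twist h r v) (maps w) (maps w)"
    by (rule bij_betw_byWitness[where f' = "\<lambda>h. twist h r v"])
       (use assms in \<open>auto simp: twist_twist intro: twist_in_maps\<close>)
  then show ?thesis unfolding mean_def by (metis sum.reindex_bij_betw)
qed

text \<open>For fixed \<open>r\<close> and \<open>v\<close>, adding the rank-one map \<open>x \<mapsto> r(x) v\<close> permutes \<open>maps w\<close>, and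
  \<open>twist h r v\<close> is \<open>extend w h r\<close> followed by the quotient by \<open>(v, 1)\<close>.\<close>

lemma mean_maps_step:
  assumes "\<And>h r. h \<in> maps w \<Longrightarrow> r \<in> D \<Longrightarrow>
      mean (\<lambda>v. F (twist h r v)) (labels w) \<le> G (extend w h r)"
  shows "mean F (maps w) \<le> mean G (maps (Suc w))"
proof -
  have D: "finite D" "D \<noteq> {}" using finite_D zero_D by auto
  \<comment> \<open>Averaging additionally over \<open>r\<close> and \<open>v\<close> changes
    nothing, as each twist permutes \<open>maps w\<close>. Afterwards the average over
    \<open>v\<close> is moved innermost.\<close>
  have "mean F (maps w) = mean (\<lambda>r. mean (\<lambda>v. mean (\<lambda>h. F (twist h r v)) (maps w)) (labels w)) D"
  proof -
    have "mean (\<lambda>v. mean (\<lambda>h. F (twist h r v)) (maps w)) (labels w) = mean F (maps w)"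
      if "r \<in> D" for r
    proof -
      have "mean (\<lambda>v. mean (\<lambda>h. F (twist h r v)) (maps w)) (labels w)
          = mean (\<lambda>v. mean F (maps w)) (labels w)"
        using that by (intro mean_cong[of "labels w"] mean_maps_twist)
      then show ?thesis by (simp add: mean_const finite_labels labels_nonempty)
    qed
    then have "mean (\<lambda>r. mean (\<lambda>v. mean (\<lambda>h. F (twist h r v)) (maps w)) (labels w)) D
        = mean (\<lambda>r. mean F (maps w)) D"
      by (rule mean_cong)
    then show ?thesis using D by (simp add: mean_const)
  qed
  also have "\<dots> = mean (\<lambda>r. mean (\<lambda>h. mean (\<lambda>v. F (twist h r v)) (labels w)) (maps w)) D"
    by (intro mean_cong mean_swap)
  also have "\<dots> \<le> mean (\<lambda>r. mean (\<lambda>h. G (extend w h r)) (maps w)) D"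
    using assms by (intro mean_mono)
  also have "\<dots> = mean G (maps (Suc w))" by (rule mean_maps_Suc[symmetric])
  finally show ?thesis .
qed

text \<open>The quotient by (v, 1) identifies (y, 0) with (y + v, 1). Points with r x = 0 lie in the
  first half of the bins and keep their label; those with r x = 1 lie in the second half and are
  shifted by \<open>v\<close>.\<close>

lemma load_twist:
  assumes "h \<in> maps w" "y \<in> labels w" "v \<in> labels w"
  shows "load S (twist h r v) y
    = load S (extend w h r) (y(w := 0)) + load S (extend w h r) ((\<lambda>i. y i + v i)(w := 1))"
proof -
  have w: "h x w = 0" "y w = 0" "v w = 0" for x
    using assms by (auto simp: maps_def labels_def)
  have "twist h r v x = y \<longleftrightarrow> extend w h r x = y(w := 0) \<or> extend w h r x = (\<lambda>i. y i + v i)(w := 1)" for x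
  proof (cases "r x")
    case zero
    then have "twist h r v x = h x" "extend w h r x = h x" "y(w := 0) = y"
      using w by (simp_all add: twist_def extend_def fun_eq_iff)
    moreover have "h x \<noteq> (\<lambda>i. y i + v i)(w := 1)"
      using w(1)[of x] by (metis fun_upd_same zero_neq_one)
    ultimately show ?thesis by simp
  next
    case one
    then have twist: "twist h r v x = (\<lambda>i. h x i + v i)" and ext: "extend w h r x = (h x)(w := 1)"
      by (simp_all add: twist_def extend_def)
    have "(\<lambda>i. h x i + v i) = y \<longleftrightarrow> (h x)(w := 1) = (\<lambda>i. y i + v i)(w := 1)"
    proof
      assume "(\<lambda>i. h x i + v i) = y"
      then have "y i + v i = h x i" for i
        using bit_add_self[of "v i"] by (simp add: fun_eq_iff add.assoc flip: \<open>_ = y\<close>)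
      then show "(h x)(w := 1) = (\<lambda>i. y i + v i)(w := 1)" by simp
    next
      assume eq: "(h x)(w := 1) = (\<lambda>i. y i + v i)(w := 1)"
      have "h x i = y i + v i" for i
        using fun_cong[OF eq, of i] w by (cases "i = w") simp_all
      then show "(\<lambda>i. h x i + v i) = y" by (simp add: fun_eq_iff add.assoc bit_add_self)
    qed
    moreover have "(h x)(w := 1) \<noteq> y(w := 0)" by (metis fun_upd_same zero_neq_one)
    ultimately show ?thesis by (simp add: twist ext)
  qed
  then have "{x \<in> S. twist h r v x = y} = {x \<in> S. extend w h r x = y(w := 0)}
      \<union> {x \<in> S. extend w h r x = (\<lambda>i. y i + v i)(w := 1)}" by auto
  moreover have "y(w := 0) \<noteq> (\<lambda>i. y i + v i)(w := 1)" by (auto simp: fun_eq_iff)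
  ultimately show ?thesis unfolding load_def using finite_S
    by (subst card_Un_disjoint[symmetric]) (auto intro!: arg_cong[where f = card])
qed

lemma potential_twist:
  assumes "h \<in> maps w" "v \<in> labels w"
  shows "potential c S w (twist h r v) = mean (\<lambda>y. c ^ load S (extend w h r) (y(w := 0)) *
    c ^ load S (extend w h r) ((\<lambda>i. y i + v i)(w := 1))) (labels w)"
  unfolding potential_def using assms by (intro mean_cong) (simp add: load_twist power_add)

text \<open>Powers turn the sum of two loads into a product, and the uniform shift turns its mean
  into the product of the means over the two halves. Their average is the potential one level up, so
  AM-GM concludes.\<close>

lemma mean_potential_twist_le:
  assumes "h \<in> maps w"
  shows "mean (\<lambda>v. potential c S w (twist h r v)) (labels w) \<le> (potential c S (Suc w) (extend w h r))\<^sup>2"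
proof -
  let ?L = "\<lambda>b y. c ^ load S (extend w h r) (y(w := b))"
  let ?A = "\<lambda>b. mean (?L b) (labels w)"
  have "mean (\<lambda>v. potential c S w (twist h r v)) (labels w)
      = mean (\<lambda>v. mean (\<lambda>y. ?L 0 y * ?L 1 (\<lambda>i. y i + v i)) (labels w)) (labels w)"
    using assms by (intro mean_cong) (rule potential_twist)
  also have "\<dots> = ?A 0 * ?A 1" by (rule mean_labels_convolution)
  also have "\<dots> \<le> ((?A 0 + ?A 1) / 2)\<^sup>2"
    using zero_le_power2[of "?A 0 - ?A 1"] by (simp add: power2_eq_square field_simps)
  finally show ?thesis by (simp add: potential_def mean_labels_Suc)
qed

text \<open>From (A-1)(B-1) >= 0 in each pair of bins. The excess of the potential over 1 thus at
  least doubles in every merge, as \<open>mean_barrier_le\<close> requires.\<close>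

lemma potential_twist_ge:
  assumes "h \<in> maps w" "v \<in> labels w" "c \<ge> 1"
  shows "potential c S w (twist h r v) \<ge> 2 * potential c S (Suc w) (extend w h r) - 1"
proof -
  let ?L = "\<lambda>b y. c ^ load S (extend w h r) (y(w := b))"
  have "2 * potential c S (Suc w) (extend w h r) - 1
      = mean (?L 0) (labels w) + mean (\<lambda>y. ?L 1 (\<lambda>i. v i + y i)) (labels w) + mean (\<lambda>_. - 1) (labels w)"
    using assms(2)
    by (simp add: potential_def mean_labels_Suc mean_const finite_labels labels_nonempty
      mean_labels_shift[where F = "?L 1"])
  also have "\<dots> = mean (\<lambda>y. ?L 0 y + ?L 1 (\<lambda>i. v i + y i) + - 1) (labels w)"
    by (simp only: mean_add)
  also have "\<dots> \<le> mean (\<lambda>y. ?L 0 y * ?L 1 (\<lambda>i. y i + v i)) (labels w)"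
  proof (rule mean_mono)
    fix y
    have "0 \<le> (?L 0 y - 1) * (?L 1 (\<lambda>i. y i + v i) - 1)"
      using assms(3) by (intro mult_nonneg_nonneg) auto
    then show "?L 0 y + ?L 1 (\<lambda>i. v i + y i) + - 1 \<le> ?L 0 y * ?L 1 (\<lambda>i. y i + v i)"
      by (simp add: algebra_simps)
  qed
  finally show ?thesis using potential_twist[OF assms(1,2), of c r] by simp
qed

lemma potential_pos:
  assumes "c > 0"
  shows "potential c S w h > 0"
  unfolding potential_def mean_def using assms
  by (intro divide_pos_pos sum_pos) (auto simp: finite_labels labels_nonempty card_labels)

lemma potential_ge_1:
  assumes "c \<ge> 1"
  shows "potential c S w h \<ge> 1"
proof -
  have "mean (\<lambda>_. 1) (labels w) \<le> potential c S w h"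
    unfolding potential_def using assms by (intro mean_mono) simp
  then show ?thesis by (simp add: mean_const finite_labels labels_nonempty)
qed

lemma power_load_le_potential:
  assumes "c > 0" "y \<in> labels w"
  shows "c ^ load S h y \<le> 2 ^ w * potential c S w h"
proof -
  have "c ^ load S h y \<le> (\<Sum>y\<in>labels w. c ^ load S h y)"
    using assms by (intro member_le_sum) (auto simp: finite_labels)
  then show ?thesis by (simp add: potential_def mean_def card_labels)
qed

section \<open>Pairwise independence\<close>

text \<open>Adding a functional that separates the two points exchanges the functionals that agree
  on them with those that do not.\<close>

lemma card_D_collision:
  assumes "x \<in> S" "y \<in> S" "x \<noteq> y"
  shows "2 * card {r \<in> D. r x = r y} = card D"
proof -
  obtain s where s: "s \<in> D" "s x \<noteq> s y" using separating assms by blast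
  have add_eq: "s x + r x = s y + r y \<longleftrightarrow> r x \<noteq> r y" for r :: "'a \<Rightarrow> bit"
    using s(2) by (cases "s x"; cases "s y"; cases "r x"; cases "r y") simp_all
  have "bij_betw (\<lambda>r x. s x + r x) {r \<in> D. r x = r y} {r \<in> D. r x \<noteq> r y}"
    by (rule bij_betw_byWitness[where f' = "\<lambda>r x. s x + r x"])
       (use s add_D in \<open>auto simp: bit_add_self_left add_eq\<close>)
  then have eq: "card {r \<in> D. r x = r y} = card {r \<in> D. r x \<noteq> r y}" by (rule bij_betw_same_card)
  have "card D = card ({r \<in> D. r x = r y} \<union> {r \<in> D. r x \<noteq> r y})"
    by (rule arg_cong[where f = card]) auto
  also have "\<dots> = card {r \<in> D. r x = r y} + card {r \<in> D. r x \<noteq> r y}"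
    using finite_D by (intro card_Un_disjoint) auto
  finally show ?thesis using eq by simp
qed

text \<open>Each independent coordinate halves the collision probability.\<close>

lemma mean_collision:
  assumes "x \<in> S" "y \<in> S" "x \<noteq> y"
  shows "mean (\<lambda>h. of_bool (h x = h y)) (maps w) = 1 / 2 ^ w"
proof (induction w)
  case 0
  show ?case by (simp add: maps_0 mean_def)
next
  case (Suc w)
  have half: "mean (\<lambda>r. of_bool (r x = r y)) D = 1 / 2"
  proof -
    have "{r \<in> D. r x = r y} = D \<inter> {r. r x = r y}" by auto
    then have "mean (\<lambda>r. of_bool (r x = r y)) D = real (card {r \<in> D. r x = r y}) / real (card D)"
      using finite_D by (simp add: mean_def of_bool_def sum.If_cases)
    moreover have "real (card D) = real (2 * card {r \<in> D. r x = r y})"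
      by (simp only: card_D_collision[OF assms])
    ultimately show ?thesis using card_D_pos by (simp add: field_simps)
  qed
  have ext: "of_bool (extend w h r x = extend w h r y) = of_bool (r x = r y) * (of_bool (h x = h y) :: real)"
    if "h \<in> maps w" for h r
  proof -
    have w: "h x w = h y w" using that by (simp add: maps_def)
    have "r x = r y \<and> h x = h y" if eq: "(h x)(w := r x) = (h y)(w := r y)"
    proof
      show "h x = h y"
      proof
        fix i show "h x i = h y i" using fun_cong[OF eq, of i] w by (cases "i = w") simp_all
      qed
    qed (use fun_cong[OF eq, of w] in simp)
    then have "(h x)(w := r x) = (h y)(w := r y) \<longleftrightarrow> r x = r y \<and> h x = h y" by auto
    then show ?thesis by (simp add: extend_def)
  qed
  have "mean (\<lambda>h. of_bool (h x = h y)) (maps (Suc w))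
      = mean (\<lambda>r. mean (\<lambda>h. of_bool (r x = r y) * of_bool (h x = h y)) (maps w)) D"
    unfolding mean_maps_Suc by (intro mean_cong) (rule ext)
  also have "\<dots> = mean (\<lambda>r. 1 / 2 ^ w * of_bool (r x = r y)) D"
    by (intro mean_cong) (simp add: mean_cmult Suc)
  also have "\<dots> = 1 / 2 ^ Suc w" unfolding mean_cmult half by simp
  finally show ?case .
qed

section \<open>Lower tail\<close>

text \<open>Jensen for the concave power, with tangent at the squared potential \<open>q\<close>:
  the conditional mean is at most \<open>q\<close> and the slope \<open>?s\<close> is nonnegative.
  The square doubles the exponent.\<close>

lemma mean_potential_powr_step:
  assumes "c > 0" "0 \<le> \<theta>" "\<theta> \<le> 1"
  shows "mean (\<lambda>h. potential c S w h powr \<theta>) (maps w)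
    \<le> mean (\<lambda>h. potential c S (Suc w) h powr (2 * \<theta>)) (maps (Suc w))"
proof (rule mean_maps_step)
  fix h r assume h: "h \<in> maps w"
  define q where "q = (potential c S (Suc w) (extend w h r))\<^sup>2"
  have pos: "potential c S (Suc w) (extend w h r) > 0" using assms(1) by (rule potential_pos)
  then have q: "q > 0" by (simp add: q_def)
  let ?s = "\<theta> * q powr \<theta> / q"
  have "mean (\<lambda>v. potential c S w (twist h r v) powr \<theta>) (labels w)
      \<le> mean (\<lambda>v. (q powr \<theta> - ?s * q) + ?s * potential c S w (twist h r v)) (labels w)"
  proof (rule mean_mono)
    fix v
    show "potential c S w (twist h r v) powr \<theta> \<le> (q powr \<theta> - ?s * q) + ?s * potential c S w (twist h r v)"
      using powr_le_tangent[OF potential_pos[OF assms(1), of w "twist h r v"] q assms(2,3)]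
      by (simp only: right_diff_distrib)
  qed
  also have "\<dots> = (q powr \<theta> - ?s * q) + ?s * mean (\<lambda>v. potential c S w (twist h r v)) (labels w)"
    by (rule mean_affine) (rule finite_labels labels_nonempty)+
  also have "\<dots> \<le> (q powr \<theta> - ?s * q) + ?s * q"
    using mean_potential_twist_le[OF h, of c r] q assms(2)
    by (intro add_left_mono mult_left_mono) (auto simp: q_def)
  also have "\<dots> = q powr \<theta>" by simp
  also have "\<dots> = potential c S (Suc w) (extend w h r) powr (2 * \<theta>)"
    using pos by (simp add: q_def powr_powr flip: powr_numeral)
  finally show "mean (\<lambda>v. potential c S w (twist h r v) powr \<theta>) (labels w)
      \<le> potential c S (Suc w) (extend w h r) powr (2 * \<theta>)" .
qed

text \<open>After \<open>k\<close> doublings the exponent 1/2^k has become 1.\<close>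

lemma mean_potential_powr_le:
  assumes "c > 0"
  shows "mean (\<lambda>h. potential c S w h powr (1 / 2 ^ k)) (maps w)
    \<le> mean (potential c S (w + k)) (maps (w + k))"
proof (induction k arbitrary: w)
  case 0
  show ?case using potential_pos[OF assms, of w] by (simp add: less_imp_le)
next
  case (Suc k)
  have "mean (\<lambda>h. potential c S w h powr (1 / 2 ^ Suc k)) (maps w)
    \<le> mean (\<lambda>h. potential c S (Suc w) h powr (2 * (1 / 2 ^ Suc k))) (maps (Suc w))"
    by (rule mean_potential_powr_step[OF assms]) (use one_le_power[of "2 :: real" "Suc k"] in \<open>auto simp: field_simps\<close>)
  also have "\<dots> = mean (\<lambda>h. potential c S (Suc w) h powr (1 / 2 ^ k)) (maps (Suc w))" by simp
  also have "\<dots> \<le> mean (potential c S (Suc w + k)) (maps (Suc w + k))" by (rule Suc)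
  finally show ?case by simp
qed

lemma load_eq_sum: "real (load S h y) = (\<Sum>x\<in>S. of_bool (h x = y))"
proof -
  have "{x \<in> S. h x = y} = S \<inter> {x. h x = y}" by auto
  then show ?thesis unfolding load_def using finite_S by (simp add: of_bool_def sum.If_cases)
qed

lemma mean_load:
  assumes "h \<in> maps w"
  shows "mean (\<lambda>y. real (load S h y)) (labels w) = real (card S) / 2 ^ w"
proof -
  have "(\<Sum>y\<in>labels w. real (load S h y)) = (\<Sum>x\<in>S. \<Sum>y\<in>labels w. of_bool (h x = y))"
    unfolding load_eq_sum by (rule sum.swap)
  also have "\<dots> = (\<Sum>x\<in>S. 1)"
    using maps_label[OF assms] by (intro sum.cong) (auto simp: of_bool_def sum.delta' finite_labels)
  finally show ?thesis by (simp add: mean_def card_labels)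
qed

text \<open>The sum of squared loads counts ordered colliding pairs, the diagonal included.\<close>

lemma mean_load_square:
  assumes "h \<in> maps w"
  shows "mean (\<lambda>y. (real (load S h y))\<^sup>2) (labels w) = (\<Sum>x\<in>S. \<Sum>x'\<in>S. of_bool (h x = h x')) / 2 ^ w"
proof -
  have "(\<Sum>y\<in>labels w. (real (load S h y))\<^sup>2)
      = (\<Sum>y\<in>labels w. \<Sum>x\<in>S. of_bool (h x = y) * real (load S h y))"
    by (simp add: load_eq_sum power2_eq_square sum_distrib_right)
  also have "\<dots> = (\<Sum>x\<in>S. \<Sum>y\<in>labels w. of_bool (h x = y) * real (load S h y))"
    by (rule sum.swap)
  also have "\<dots> = (\<Sum>x\<in>S. real (load S h (h x)))"
    using maps_label[OF assms]
    by (intro sum.cong refl) (auto simp: of_bool_def if_distrib[of "\<lambda>b. b * _"] sum.delta' finite_labels cong: if_cong)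
  also have "\<dots> = (\<Sum>x\<in>S. \<Sum>x'\<in>S. of_bool (h x = h x'))"
    unfolding load_eq_sum by (intro sum.cong refl arg_cong[where f = of_bool]) auto
  finally show ?thesis by (simp add: mean_def card_labels)
qed

lemma mean_collisions_le:
  "mean (\<lambda>h. \<Sum>x\<in>S. \<Sum>x'\<in>S. of_bool (h x = h x')) (maps w)
    \<le> real (card S) + (real (card S))\<^sup>2 / 2 ^ w"
proof -
  have "mean (\<lambda>h. of_bool (h x = h x')) (maps w) \<le> of_bool (x = x') + 1 / 2 ^ w"
    if "x \<in> S" "x' \<in> S" for x x'
    using mean_collision[OF that] by (cases "x = x'") (simp_all add: mean_const finite_maps maps_nonempty)
  then have "mean (\<lambda>h. \<Sum>x\<in>S. \<Sum>x'\<in>S. of_bool (h x = h x')) (maps w)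
      \<le> (\<Sum>x\<in>S. \<Sum>x'\<in>S. of_bool (x = x') + 1 / 2 ^ w)"
    by (simp only: mean_sum) (intro sum_mono)
  also have "\<dots> = real (card S) + (real (card S))\<^sup>2 / 2 ^ w"
    using finite_S by (simp add: sum.distrib of_bool_def power2_eq_square algebra_simps)
  finally show ?thesis .
qed

text \<open>Second moment method: pairwise independence keeps the variance of the load at the order
  of its mean \<mu>.\<close>

lemma mean_half_potential_le:
  assumes "S \<noteq> {}"
  shows "mean (potential (1 / 2) S w) (maps w) \<le> 6 * 2 ^ w / real (card S)"
proof -
  define \<mu> where "\<mu> = real (card S) / 2 ^ w"
  have mu: "\<mu> > 0" using assms finite_S by (simp add: \<mu>_def card_gt_0_iff)
  \<comment> \<open>The quadratic is expanded and the mean load \<mu> inserted, so its constant and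
    linear terms give 4 - 8 = -4. The off-diagonal pairs later cancel this, leaving 2/\<mu> +
    4/\<mu>.\<close>
  have "potential (1 / 2) S w h \<le> (2 / \<mu> - 4) + 4 / \<mu>\<^sup>2 / 2 ^ w * (\<Sum>x\<in>S. \<Sum>x'\<in>S. of_bool (h x = h x'))"
    if h: "h \<in> maps w" for h
  proof -
    have "potential (1 / 2) S w h \<le> mean (\<lambda>y. (4 + 2 / \<mu> + (- 8 / \<mu>) * real (load S h y))
        + 4 / \<mu>\<^sup>2 * (real (load S h y))\<^sup>2) (labels w)"
      unfolding potential_def
    proof (rule mean_mono)
      fix y
      show "(1 / 2) ^ load S h y \<le> (4 + 2 / \<mu> + (- 8 / \<mu>) * real (load S h y))
        + 4 / \<mu>\<^sup>2 * (real (load S h y))\<^sup>2"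
        using half_power_le_quadratic[OF mu, of "load S h y"] mu
        by (simp add: field_simps power2_eq_square)
    qed
    also have "\<dots> = (4 + 2 / \<mu> + (- 8 / \<mu>) * \<mu>)
        + 4 / \<mu>\<^sup>2 * ((\<Sum>x\<in>S. \<Sum>x'\<in>S. of_bool (h x = h x')) / 2 ^ w)"
      by (simp only: mean_add mean_cmult mean_load[OF h] mean_load_square[OF h]
          mean_const[OF finite_labels labels_nonempty] \<mu>_def)
    finally show ?thesis using mu by simp
  qed
  then have "mean (potential (1 / 2) S w) (maps w)
      \<le> mean (\<lambda>h. (2 / \<mu> - 4) + 4 / \<mu>\<^sup>2 / 2 ^ w * (\<Sum>x\<in>S. \<Sum>x'\<in>S. of_bool (h x = h x'))) (maps w)"
    by (rule mean_mono)
  also have "\<dots> = (2 / \<mu> - 4) + 4 / \<mu>\<^sup>2 / 2 ^ w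
      * mean (\<lambda>h. \<Sum>x\<in>S. \<Sum>x'\<in>S. of_bool (h x = h x')) (maps w)"
    by (rule mean_affine[OF finite_maps maps_nonempty])
  also have "\<dots> \<le> (2 / \<mu> - 4) + 4 / \<mu>\<^sup>2 / 2 ^ w * (real (card S) + (real (card S))\<^sup>2 / 2 ^ w)"
    using mu by (intro add_left_mono mult_left_mono mean_collisions_le) auto
  also have "\<dots> = 6 / \<mu>"
    using mu by (simp add: \<mu>_def field_simps power2_eq_square)
  finally show ?thesis by (simp add: \<mu>_def)
qed

text \<open>A light bin forces the potential to be at least 2^-(load + l), hence at least 2^-(2^k);
  its power 1/2^k is then at least 1/2, and Markov's inequality applies. The summand
  \<open>l\<close> pays for the normalisation by the number of bins.\<close>

lemma lower_tail:
  assumes "S \<noteq> {}"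
  shows "real (card {h \<in> maps l. \<exists>y\<in>labels l. load S h y + l \<le> 2 ^ k}) / real (card (maps l))
    \<le> 12 * 2 ^ (l + k) / real (card S)"
proof -
  have "real (card {h \<in> maps l. \<exists>y\<in>labels l. load S h y + l \<le> 2 ^ k}) / real (card (maps l))
    \<le> mean (\<lambda>h. 2 * potential (1 / 2) S l h powr (1 / 2 ^ k)) (maps l)"
  proof (rule mean_markov)
    fix h assume "h \<in> {h \<in> maps l. \<exists>y\<in>labels l. load S h y + l \<le> 2 ^ k}"
    then obtain y where y: "y \<in> labels l" "load S h y + l \<le> 2 ^ k" by auto
    have "(1 / 2 :: real) ^ (2 ^ k) \<le> (1 / 2) ^ (load S h y + l)"
      using y(2) by (intro power_decreasing) auto
    also have "\<dots> \<le> potential (1 / 2) S l h"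
      using power_load_le_potential[OF _ y(1), of "1 / 2" h] by (simp add: power_add field_simps power_one_over)
    finally have "((1 / 2 :: real) ^ (2 ^ k)) powr (1 / 2 ^ k) \<le> potential (1 / 2) S l h powr (1 / 2 ^ k)"
      by (intro powr_mono2) auto
    moreover have "((1 / 2 :: real) ^ (2 ^ k)) powr (1 / 2 ^ k) = 1 / 2"
      by (subst powr_realpow[symmetric]) (auto simp: powr_powr)
    ultimately show "1 \<le> 2 * potential (1 / 2) S l h powr (1 / 2 ^ k)" by simp
  qed (auto simp: finite_maps)
  also have "\<dots> \<le> 2 * (6 * 2 ^ (l + k) / real (card S))"
    unfolding mean_cmult using mean_potential_powr_le[of "1 / 2" l k] mean_half_potential_le[OF assms, of "l + k"]
    by simp
  finally show ?thesis by simp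
qed

section \<open>Upper tail\<close>

text \<open>The parameter R/2^w doubles whenever the level drops by one, exactly as in
  \<open>mean_barrier_le\<close>.\<close>

lemma mean_barrier_potential_step:
  assumes "R > 0"
  shows "mean (\<lambda>h. barrier (R / 2 ^ w) (potential 2 S w h - 1)) (maps w)
    \<le> mean (\<lambda>h. barrier (R / 2 ^ Suc w) (potential 2 S (Suc w) h - 1)) (maps (Suc w))"
proof (rule mean_maps_step)
  fix h r assume h: "h \<in> maps w"
  define a where "a = potential 2 S (Suc w) (extend w h r) - 1"
  have "mean (\<lambda>v. barrier (2 * (R / 2 ^ Suc w)) (potential 2 S w (twist h r v) - 1)) (labels w)
      \<le> barrier (R / 2 ^ Suc w) a"
  proof (rule mean_barrier_le)
    show "a \<ge> 0" using potential_ge_1[of 2 "Suc w"] by (simp add: a_def)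
    show "2 * a \<le> potential 2 S w (twist h r v) - 1" if "v \<in> labels w" for v
      using potential_twist_ge[OF h that, of 2 r] by (simp add: a_def)
    have "mean (\<lambda>v. potential 2 S w (twist h r v) - 1) (labels w)
        = - 1 + 1 * mean (\<lambda>v. potential 2 S w (twist h r v)) (labels w)"
      using mean_affine[OF finite_labels labels_nonempty, of "- 1" 1 "\<lambda>v. potential 2 S w (twist h r v)" w]
      by simp
    also have "\<dots> \<le> 2 * a + a\<^sup>2"
      using mean_potential_twist_le[OF h, of 2 r] by (simp add: a_def power2_eq_square algebra_simps)
    finally show "mean (\<lambda>v. potential 2 S w (twist h r v) - 1) (labels w) \<le> 2 * a + a\<^sup>2" .
  qed (use assms in \<open>auto simp: finite_labels labels_nonempty\<close>)
  then show "mean (\<lambda>v. barrier (R / 2 ^ w) (potential 2 S w (twist h r v) - 1)) (labels w)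
      \<le> barrier (R / 2 ^ Suc w) (potential 2 S (Suc w) (extend w h r) - 1)"
    by (simp add: a_def)
qed

lemma mean_barrier_potential_le:
  assumes "R > 0"
  shows "mean (\<lambda>h. barrier (R / 2 ^ w) (potential 2 S w h - 1)) (maps w)
    \<le> mean (\<lambda>h. barrier (R / 2 ^ (w + k)) (potential 2 S (w + k) h - 1)) (maps (w + k))"
proof (induction k)
  case (Suc k)
  then show ?case using mean_barrier_potential_step[OF assms, of "w + k"] by simp
qed simp

text \<open>All loads are 0 or 1, where 2^f = 1 + f.\<close>

lemma potential_inj:
  assumes "h \<in> maps w" "inj_on h S"
  shows "potential 2 S w h = 1 + real (card S) / 2 ^ w"
proof -
  have "(2 :: real) ^ load S h y = 1 + real (load S h y)" for y
  proof -
    have "load S h y \<le> 1" unfolding load_def One_nat_def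
      using finite_S assms(2) by (subst card_le_Suc0_iff_eq) (auto simp: inj_on_def)
    then show ?thesis by (cases "load S h y") auto
  qed
  then show ?thesis
    by (simp add: potential_def mean_add mean_const finite_labels labels_nonempty mean_load[OF assms(1)])
qed

text \<open>For injective maps a/t is card S / R. Otherwise the barrier is at most 1, which is paid
  for by the surplus of colliding pairs over the diagonal.\<close>

lemma mean_barrier_high_level:
  assumes "R > 0"
  shows "mean (\<lambda>h. barrier (R / 2 ^ w) (potential 2 S w h - 1)) (maps w)
    \<le> (real (card S) / R)\<^sup>2 + (real (card S))\<^sup>2 / 2 ^ w"
proof -
  let ?C = "\<lambda>h. \<Sum>x\<in>S. \<Sum>x'\<in>S. of_bool (h x = h x') :: real"
  have "barrier (R / 2 ^ w) (potential 2 S w h - 1)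
      \<le> ((real (card S) / R)\<^sup>2 - real (card S)) + 1 * ?C h" if h: "h \<in> maps w" for h
  proof (cases "inj_on h S")
    case True
    have "?C h = (\<Sum>x\<in>S. \<Sum>x'\<in>S. of_bool (x = x'))"
      using True by (intro sum.cong refl) (auto simp: inj_on_def)
    also have "\<dots> = real (card S)" using finite_S by (simp add: of_bool_def)
    finally have "?C h = real (card S)" .
    moreover have "barrier (R / 2 ^ w) (potential 2 S w h - 1) \<le> (real (card S) / 2 ^ w / (R / 2 ^ w))\<^sup>2"
      using assms by (simp only: potential_inj[OF h True] add_diff_cancel_left') (intro barrier_le_square, auto)
    ultimately show ?thesis by simp
  next
    case False
    then obtain x z where xz: "x \<in> S" "z \<in> S" "x \<noteq> z" "h x = h z" by (auto simp: inj_on_def)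
    \<comment> \<open>Every row of the pair count contains its diagonal entry, and the row of
      \<open>x\<close> also contains \<open>z\<close>.\<close>
    have "real (card S) + 1 = (\<Sum>x'\<in>S. 1 + of_bool (x' = x))"
      using finite_S xz by (simp add: sum.distrib of_bool_def)
    also have "\<dots> \<le> ?C h"
    proof (rule sum_mono)
      fix x' assume x': "x' \<in> S"
      show "1 + of_bool (x' = x) \<le> (\<Sum>x''\<in>S. of_bool (h x' = h x'') :: real)"
      proof (cases "x' = x")
        case True
        have "(\<Sum>x''\<in>{x, z}. of_bool (h x' = h x'')) \<le> (\<Sum>x''\<in>S. of_bool (h x' = h x'') :: real)"
          using xz finite_S by (intro sum_mono2) auto
        then show ?thesis using True xz by simp
      next
        case False
        have "(\<Sum>x''\<in>{x'}. of_bool (h x' = h x'')) \<le> (\<Sum>x''\<in>S. of_bool (h x' = h x'') :: real)"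
          using x' finite_S by (intro sum_mono2) auto
        then show ?thesis using False by simp
      qed
    qed
    finally have "real (card S) + 1 \<le> ?C h" .
    then show ?thesis using barrier_le_1[of "R / 2 ^ w" "potential 2 S w h - 1"]
        zero_le_power2[of "real (card S) / R"] by linarith
  qed
  then have "mean (\<lambda>h. barrier (R / 2 ^ w) (potential 2 S w h - 1)) (maps w)
      \<le> mean (\<lambda>h. ((real (card S) / R)\<^sup>2 - real (card S)) + 1 * ?C h) (maps w)"
    by (rule mean_mono)
  also have "\<dots> = ((real (card S) / R)\<^sup>2 - real (card S)) + 1 * mean ?C (maps w)"
    by (rule mean_affine[OF finite_maps maps_nonempty])
  also have "\<dots> \<le> (real (card S) / R)\<^sup>2 + (real (card S))\<^sup>2 / 2 ^ w"
    using mean_collisions_le[of w] by simp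
  finally show ?thesis .
qed

text \<open>Letting the starting level tend to infinity removes the collision term.\<close>

lemma mean_barrier_bound:
  assumes "R > 0"
  shows "mean (\<lambda>h. barrier (R / 2 ^ w) (potential 2 S w h - 1)) (maps w) \<le> (real (card S) / R)\<^sup>2"
proof -
  have "(\<lambda>k. (real (card S) / R)\<^sup>2 + (real (card S))\<^sup>2 / 2 ^ w * (1 / 2) ^ k)
      \<longlonglongrightarrow> (real (card S) / R)\<^sup>2 + (real (card S))\<^sup>2 / 2 ^ w * 0"
    by (intro tendsto_intros LIMSEQ_realpow_zero) auto
  moreover have "mean (\<lambda>h. barrier (R / 2 ^ w) (potential 2 S w h - 1)) (maps w)
      \<le> (real (card S) / R)\<^sup>2 + (real (card S))\<^sup>2 / 2 ^ w * (1 / 2) ^ k" for k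
    using order_trans[OF mean_barrier_potential_le[OF assms, of w k] mean_barrier_high_level[OF assms]]
    by (simp add: power_add power_one_over)
  ultimately show ?thesis using LIMSEQ_le_const by fastforce
qed

text \<open>Markov's inequality for the barrier: while it is below 1, every 2^load is at most 2^l
  exp(5t).\<close>

lemma upper_tail:
  assumes "R > 0"
  shows "real (card {h \<in> maps l. \<exists>y\<in>labels l. real (load S h y) > real l + 8 * R / 2 ^ l})
      / real (card (maps l)) \<le> (real (card S) / R)\<^sup>2"
proof -
  define t where "t = R / 2 ^ l"
  have t: "t > 0" using assms by (simp add: t_def)
  have "real (card {h \<in> maps l. \<exists>y\<in>labels l. real (load S h y) > real l + 8 * R / 2 ^ l})
      / real (card (maps l)) \<le> mean (\<lambda>h. barrier t (potential 2 S l h - 1)) (maps l)"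
  proof (rule mean_markov)
    fix h assume "h \<in> {h \<in> maps l. \<exists>y\<in>labels l. real (load S h y) > real l + 8 * R / 2 ^ l}"
    then obtain y where y: "y \<in> labels l" "real (load S h y) > real l + 8 * t" by (auto simp: t_def)
    show "1 \<le> barrier t (potential 2 S l h - 1)"
    proof (rule ccontr)
      assume "\<not> ?thesis"
      then have "potential 2 S l h \<le> exp (5 * t)"
        using barrier_less_1_imp_le_exp[OF t, of "potential 2 S l h - 1"] potential_ge_1[of 2 l h] by simp
      then have "2 ^ l * potential 2 S l h \<le> 2 ^ l * exp (5 * t)" by simp
      then have "2 ^ load S h y \<le> 2 ^ l * exp (5 * t)"
        using power_load_le_potential[OF _ y(1), of 2 h] by linarith
      then have "ln (2 ^ load S h y) \<le> ln (2 ^ l * exp (5 * t))" by simp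
      then have "real (load S h y) * ln 2 \<le> real l * ln 2 + 5 * t"
        by (simp add: ln_mult ln_realpow)
      moreover have "(real l + 8 * t) * ln 2 < real (load S h y) * ln 2"
        using y(2) by (intro mult_strict_right_mono) auto
      \<comment> \<open>The constant 8 of the statement comes from 8 ln 2 >= 16/3 > 5.\<close>
      moreover have "5 * t \<le> (8 * ln 2) * t" using t ln2_ge_two_thirds by (intro mult_right_mono) auto
      ultimately show False by (simp add: algebra_simps)
    qed
  next
    fix h show "0 \<le> barrier t (potential 2 S l h - 1)"
      using potential_ge_1[of 2 l h] t by (intro barrier_nonneg) auto
  qed (auto simp: finite_maps)
  also have "\<dots> \<le> (real (card S) / R)\<^sup>2" unfolding t_def by (rule mean_barrier_bound[OF assms])
  finally show ?thesis .
qed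

end

section \<open>Linear maps between binary vector spaces\<close>

lemma finite_carrier_vec_bit: "finite (carrier_vec u :: bit vec set)"
proof (rule finite_subset)
  show "(carrier_vec u :: bit vec set) \<subseteq> vec u ` labels u"
  proof
    fix x :: "bit vec" assume "x \<in> carrier_vec u"
    then have "x = vec u (\<lambda>i. if i < u then x $ i else 0)" by (intro eq_vecI) auto
    then show "x \<in> vec u ` labels u" by (auto simp: labels_def)
  qed
qed (simp add: finite_labels)

lemma bit_vec_add_self:
  assumes "x \<in> carrier_vec u"
  shows "x + x = (0\<^sub>v u :: bit vec)"
  using assms by (intro eq_vecI) (auto simp: bit_add_self)

text \<open>With only the scalars 0 and 1, additivity implies homogeneity; g 0 = 0 follows from x +
  x = 0.\<close>

lemma linear_maps_F2_iff:
  "g \<in> linear_maps_F2 u l \<longleftrightarrow> g \<in> extensional (carrier_vec u) \<and>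
    (\<forall>x\<in>carrier_vec u. g x \<in> carrier_vec l) \<and>
    (\<forall>x\<in>carrier_vec u. \<forall>y\<in>carrier_vec u. g (x + y) = g x + g y)"
proof -
  have smult: "g (r \<cdot>\<^sub>v x) = r \<cdot>\<^sub>v g x"
    if g: "\<forall>x\<in>carrier_vec u. g x \<in> carrier_vec l"
      and add: "\<forall>x\<in>carrier_vec u. \<forall>y\<in>carrier_vec u. g (x + y) = g x + g y"
      and x: "x \<in> carrier_vec u" for r x
  proof (cases r)
    case zero
    have "g (x + x) = g x + g x" using add x by blast
    then have "g (0\<^sub>v u) = 0\<^sub>v l" using bit_vec_add_self x g by metis
    moreover have "0 \<cdot>\<^sub>v x = 0\<^sub>v u" using x by (intro eq_vecI) auto
    moreover have "0 \<cdot>\<^sub>v g x = 0\<^sub>v l" using bspec[OF g x] by (intro eq_vecI) auto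
    ultimately show ?thesis using zero by simp
  next
    case one
    then show ?thesis by simp
  qed
  show ?thesis
    unfolding linear_maps_F2_def LinearCombinations.module_hom_def module_vec_simps
    using smult by auto
qed

text \<open>The value 0 off the carrier gives each functional a single representative and keeps the
  set finite.\<close>

definition functionals :: "nat \<Rightarrow> (bit vec \<Rightarrow> bit) set" where
  "functionals u = {r. (\<forall>x. x \<notin> carrier_vec u \<longrightarrow> r x = 0) \<and>
    (\<forall>x\<in>carrier_vec u. \<forall>y\<in>carrier_vec u. r (x + y) = r x + r y)}"

lemma functional_system_functionals:
  assumes "S \<subseteq> carrier_vec u"
  shows "functional_system (functionals u) S"
proof
  have "functionals u \<subseteq> {r. \<forall>x. (x \<in> carrier_vec u \<longrightarrow> r x \<in> UNIV) \<and> (x \<notin> carrier_vec u \<longrightarrow> r x = 0)}"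
    by (auto simp: functionals_def)
  moreover have "finite {r. \<forall>x. (x \<in> (carrier_vec u :: bit vec set) \<longrightarrow> r x \<in> (UNIV :: bit set)) \<and>
      (x \<notin> carrier_vec u \<longrightarrow> r x = 0)}"
    by (intro finite_set_of_finite_funs finite_carrier_vec_bit) (simp add: UNIV_bit)
  ultimately show "finite (functionals u)" by (rule finite_subset)
  show "finite S" using assms finite_carrier_vec_bit by (rule finite_subset)
  show "(\<lambda>_. 0) \<in> functionals u" by (simp add: functionals_def)
  show "(\<lambda>x. r x + s x) \<in> functionals u" if "r \<in> functionals u" "s \<in> functionals u" for r s
    using that by (simp add: functionals_def add_ac)
  \<comment> \<open>Coordinate functionals separate distinct vectors.\<close>
  show "\<exists>r\<in>functionals u. r x \<noteq> r y" if S: "x \<in> S" "y \<in> S" and neq: "x \<noteq> y" for x y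
  proof -
    have xy: "x \<in> carrier_vec u" "y \<in> carrier_vec u" using S assms by auto
    then obtain i where i: "i < u" "x $ i \<noteq> y $ i" using neq by (metis eq_vecI carrier_vecD)
    have "(\<lambda>x. if x \<in> carrier_vec u then x $ i else 0) \<in> functionals u"
      using i(1) by (auto simp: functionals_def)
    then show ?thesis using i xy by (intro bexI) auto
  qed
qed

context
  fixes u :: nat and S :: "bit vec set"
  assumes S: "S \<subseteq> carrier_vec u"
begin

interpretation functional_system "functionals u" S
  by (rule functional_system_functionals[OF S])

lemma maps_functionals_iff:
  "h \<in> maps l \<longleftrightarrow> (\<forall>i<l. (\<forall>x. x \<notin> carrier_vec u \<longrightarrow> h x i = 0) \<and>
      (\<forall>x\<in>carrier_vec u. \<forall>y\<in>carrier_vec u. h (x + y) i = h x i + h y i)) \<and>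
    (\<forall>x. \<forall>i\<ge>l. h x i = 0)"
  unfolding maps_def by (simp add: functionals_def)

definition to_linear :: "nat \<Rightarrow> (bit vec \<Rightarrow> nat \<Rightarrow> bit) \<Rightarrow> bit vec \<Rightarrow> bit vec" where
  "to_linear l h = restrict (\<lambda>x. vec l (h x)) (carrier_vec u)"

text \<open>Carries the uniform distribution on tuples of functionals to the one on linear
  maps.\<close>

lemma bij_betw_to_linear: "bij_betw (to_linear l) (maps l) (linear_maps_F2 u l)"
proof (rule bij_betw_byWitness[where f' = "\<lambda>g x i. if x \<in> carrier_vec u \<and> i < l then g x $ i else 0"])
  show "\<forall>h\<in>maps l. (\<lambda>x i. if x \<in> carrier_vec u \<and> i < l then to_linear l h x $ i else 0) = h"
  proof
    fix h assume h: "h \<in> maps l"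
    show "(\<lambda>x i. if x \<in> carrier_vec u \<and> i < l then to_linear l h x $ i else 0) = h"
    proof (intro ext)
      fix x i
      have "h x i = 0" if "x \<notin> carrier_vec u \<or> \<not> i < l"
        using h that by (cases "i < l") (auto simp: maps_functionals_iff)
      then show "(if x \<in> carrier_vec u \<and> i < l then to_linear l h x $ i else 0) = h x i"
        by (auto simp: to_linear_def)
    qed
  qed
  show "\<forall>g\<in>linear_maps_F2 u l. to_linear l (\<lambda>x i. if x \<in> carrier_vec u \<and> i < l then g x $ i else 0) = g"
  proof
    fix g assume g: "g \<in> linear_maps_F2 u l"
    show "to_linear l (\<lambda>x i. if x \<in> carrier_vec u \<and> i < l then g x $ i else 0) = g"
    proof
      fix x
      show "to_linear l (\<lambda>x i. if x \<in> carrier_vec u \<and> i < l then g x $ i else 0) x = g x"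
      proof (cases "x \<in> carrier_vec u")
        case True
        then have "g x \<in> carrier_vec l" using g by (simp add: linear_maps_F2_iff)
        then show ?thesis using True by (intro eq_vecI) (auto simp: to_linear_def)
      next
        case False
        then show ?thesis using g by (simp add: linear_maps_F2_iff to_linear_def extensional_def)
      qed
    qed
  qed
  show "to_linear l ` maps l \<subseteq> linear_maps_F2 u l"
  proof
    fix g assume "g \<in> to_linear l ` maps l"
    then obtain h where h: "h \<in> maps l" and g: "g = to_linear l h" by auto
    have "h (x + y) i = h x i + h y i" if "i < l" "x \<in> carrier_vec u" "y \<in> carrier_vec u" for i x y
      using h that by (auto simp: maps_functionals_iff)
    then show "g \<in> linear_maps_F2 u l"
      unfolding g linear_maps_F2_iff by (auto simp: to_linear_def intro!: eq_vecI)
  qed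
  show "(\<lambda>g x i. if x \<in> carrier_vec u \<and> i < l then g x $ i else 0) ` linear_maps_F2 u l \<subseteq> maps l"
  proof
    fix h assume "h \<in> (\<lambda>g x i. if x \<in> carrier_vec u \<and> i < l then g x $ i else 0) ` linear_maps_F2 u l"
    then obtain g where g: "g \<in> linear_maps_F2 u l"
      and h: "h = (\<lambda>x i. if x \<in> carrier_vec u \<and> i < l then g x $ i else 0)" by auto
    have "g (x + y) $ i = g x $ i + g y $ i" if "i < l" "x \<in> carrier_vec u" "y \<in> carrier_vec u" for i x y
    proof -
      have "g (x + y) = g x + g y" "g y \<in> carrier_vec l" using g that by (auto simp: linear_maps_F2_iff)
      then show ?thesis using that(1) by simp
    qed
    then show "h \<in> maps l" by (auto simp: h maps_functionals_iff)
  qed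
qed

lemma card_fibre_to_linear:
  assumes "h \<in> maps l" "y \<in> carrier_vec l"
  shows "\<exists>z\<in>labels l. card (to_linear l h -` {y} \<inter> S) = load S h z"
proof
  let ?z = "\<lambda>i. if i < l then y $ i else 0"
  show "?z \<in> labels l" by (simp add: labels_def)
  have "to_linear l h x = y \<longleftrightarrow> h x = ?z" if "x \<in> S" for x
  proof -
    have "to_linear l h x = vec l (h x)" using that S by (auto simp: to_linear_def)
    moreover have "h x i = 0" if "\<not> i < l" for i using assms(1) that by (auto simp: maps_functionals_iff)
    ultimately show ?thesis using assms(2) by (auto simp: fun_eq_iff vec_eq_iff)
  qed
  then have "to_linear l h -` {y} \<inter> S = {x \<in> S. h x = ?z}" by auto
  then show "card (to_linear l h -` {y} \<inter> S) = load S h ?z" by (simp add: load_def)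
qed

text \<open>Union bound over the two tails. The bounds \<open>a\<close> and \<open>b\<close> stay
  abstract, which postpones the choice of constants.\<close>

lemma prob_linear_map_loads:
  assumes "S \<noteq> {}" "R > 0"
    and lower: "\<And>i. 2 ^ k < i + l \<Longrightarrow> a \<le> real i"
    and upper: "real l + 8 * R / 2 ^ l \<le> b"
  shows "1 - 12 * 2 ^ (l + k) / real (card S) - (real (card S) / R)\<^sup>2
    \<le> measure_pmf.prob (pmf_of_set (linear_maps_F2 u l))
        {h. \<forall>y\<in>carrier_vec l. a \<le> real (card (h -` {y} \<inter> S)) \<and> real (card (h -` {y} \<inter> S)) \<le> b}"
    (is "_ \<le> measure_pmf.prob (pmf_of_set ?H) ?E")
proof -
  define B where "B = {h \<in> maps l. \<exists>y\<in>labels l. load S h y + l \<le> 2 ^ k}"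
  define C where "C = {h \<in> maps l. \<exists>y\<in>labels l. real (load S h y) > real l + 8 * R / 2 ^ l}"
  have H: "finite ?H" "?H \<noteq> {}" and card_H: "card ?H = card (maps l)"
    using bij_betw_finite[OF bij_betw_to_linear] bij_betw_to_linear[of l] finite_maps maps_nonempty
      bij_betw_same_card[OF bij_betw_to_linear] by (auto simp: bij_betw_def)
  have good: "to_linear l ` (maps l - (B \<union> C)) \<subseteq> ?H \<inter> ?E"
  proof
    fix g assume "g \<in> to_linear l ` (maps l - (B \<union> C))"
    then obtain h where h: "h \<in> maps l" "h \<notin> B" "h \<notin> C" and g: "g = to_linear l h" by auto
    have "a \<le> real (card (g -` {y} \<inter> S)) \<and> real (card (g -` {y} \<inter> S)) \<le> b"
      if y: "y \<in> carrier_vec l" for y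
    proof -
      obtain z where z: "z \<in> labels l" "card (g -` {y} \<inter> S) = load S h z"
        using card_fibre_to_linear[OF h(1) y] g by auto
      have "2 ^ k < load S h z + l" using h z(1) by (auto simp: B_def not_le)
      moreover have "real (load S h z) \<le> b" using h z(1) upper by (force simp: C_def not_less)
      ultimately show ?thesis using lower z(2) by simp
    qed
    then show "g \<in> ?H \<inter> ?E" using h(1) g bij_betw_to_linear[of l] by (auto simp: bij_betw_def)
  qed
  have "inj_on (to_linear l) (maps l - (B \<union> C))"
    using bij_betw_to_linear[of l] by (auto simp: bij_betw_def intro: inj_on_subset)
  then have "card (maps l - (B \<union> C)) \<le> card (?H \<inter> ?E)"
    using card_mono[OF _ good] H(1) by (simp add: card_image)
  moreover have "card (maps l) \<le> card (maps l - (B \<union> C)) + card B + card C"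
  proof -
    have sub: "B \<union> C \<subseteq> maps l" by (auto simp: B_def C_def)
    then have "card (maps l) = card (maps l - (B \<union> C)) + card (B \<union> C)"
      using finite_maps[of l] by (metis card_Diff_subset card_mono finite_subset le_add_diff_inverse2)
    then show ?thesis using card_Un_le[of B C] by linarith
  qed
  ultimately have "real (card (maps l)) \<le> real (card (?H \<inter> ?E)) + real (card B) + real (card C)" by linarith
  then have "real (card (maps l)) / real (card (maps l))
      \<le> (real (card (?H \<inter> ?E)) + real (card B) + real (card C)) / real (card (maps l))"
    by (rule divide_right_mono) simp
  then have "1 - real (card B) / real (card (maps l)) - real (card C) / real (card (maps l))
      \<le> real (card (?H \<inter> ?E)) / real (card (maps l))"
    using card_maps_pos[of l] by (simp add: add_divide_distrib)
  moreover have "real (card B) / real (card (maps l)) \<le> 12 * 2 ^ (l + k) / real (card S)"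
    unfolding B_def by (rule lower_tail[OF assms(1)])
  moreover have "real (card C) / real (card (maps l)) \<le> (real (card S) / R)\<^sup>2"
    unfolding C_def by (rule upper_tail[OF assms(2)])
  moreover have "measure_pmf.prob (pmf_of_set ?H) ?E = real (card (?H \<inter> ?E)) / real (card (maps l))"
    using measure_pmf_of_set[OF H(2,1)] card_H by simp
  ultimately show ?thesis by linarith
qed

end

section \<open>Choice of the parameters\<close>

lemma ex_power2_between:
  fixes x :: real
  assumes "x \<ge> 1"
  shows "\<exists>k. 2 ^ k \<le> x \<and> x < 2 * 2 ^ k"
proof -
  have "1 \<le> nat \<lfloor>x\<rfloor>" using assms by linarith
  then obtain k where k: "2 ^ k \<le> nat \<lfloor>x\<rfloor>" "nat \<lfloor>x\<rfloor> < 2 ^ (k + 1)"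
    using ex_power_ivl1[of 2 "nat \<lfloor>x\<rfloor>"] by auto
  have floor: "real (nat \<lfloor>x\<rfloor>) \<le> x" "x < real (nat \<lfloor>x\<rfloor>) + 1" using assms by linarith+
  have "2 ^ k = real (2 ^ k)" by simp
  also have "\<dots> \<le> real (nat \<lfloor>x\<rfloor>)" using k(1) by (rule of_nat_mono)
  finally have "2 ^ k \<le> x" using floor(1) by (rule order_trans)
  moreover have "real (nat \<lfloor>x\<rfloor> + 1) \<le> real (2 ^ (k + 1))" using k(2) by (intro of_nat_mono) simp
  then have "real (nat \<lfloor>x\<rfloor>) + 1 \<le> 2 * 2 ^ k" by (simp del: of_nat_nat)
  then have "x < 2 * 2 ^ k" using floor(2) by linarith
  ultimately show ?thesis by blast
qed

theorem theorem1p4: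
  shows "\<exists>C1 C2 :: real \<Rightarrow> real.
    (\<forall>\<epsilon>::real. 0 < \<epsilon> \<and> \<epsilon> < 1/2 \<longrightarrow>
       0 < C1 \<epsilon> \<and> C1 \<epsilon> < C2 \<epsilon> \<and>
       (\<forall>(u::nat) (l::nat) (m::nat) (n::nat) (S :: bit vec set).
          1 \<le> l \<and> l \<le> u \<and> 1 \<le> m \<and> n = 2 ^ l \<and>
          S \<subseteq> carrier_vec u \<and> card S = m \<and>
          real m \<ge> inverse (C1 \<epsilon>) * real n * log 2 (real n) \<longrightarrow>
          measure_pmf.prob (pmf_of_set (linear_maps_F2 u l))
            {h. \<forall>y \<in> carrier_vec l.
                  C1 \<epsilon> * (real m / real n) \<le> real (card (h -` {y} \<inter> S)) \<and>
                  real (card (h -` {y} \<inter> S)) \<le> C2 \<epsilon> * (real m / real n)}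
          \<ge> 1 - \<epsilon>)) \<and>
    C1 \<in> \<Omega>[principal {0<..<1/2}](\<lambda>\<epsilon>. \<epsilon> ^ 74) \<and>
    C2 \<in> O[principal {0<..<1/2}](\<lambda>\<epsilon>. \<epsilon> powr (-1/2))"
proof (rule exI[of _ "\<lambda>\<epsilon>. \<epsilon> / 96"], rule exI[of _ "\<lambda>\<epsilon>. 17 * \<epsilon> powr (-1/2)"],
    intro conjI allI impI)
  show "(\<lambda>\<epsilon>::real. \<epsilon> / 96) \<in> \<Omega>[principal {0<..<1/2}](\<lambda>\<epsilon>. \<epsilon> ^ 74)"
  proof (rule landau_omega.bigI[of "1 / 96"])
    \<comment> \<open>The lower constant obtained is linear in \<epsilon>, which dominates the
      required power as \<epsilon> < 1.\<close>
    have "\<epsilon> ^ 74 \<le> \<epsilon>" if "0 < \<epsilon>" "\<epsilon> < 1 / 2" for \<epsilon> :: real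
      using power_decreasing[of 1 74 \<epsilon>] that by simp
    then show "\<forall>\<^sub>F \<epsilon>::real in principal {0<..<1/2}. norm (\<epsilon> / 96) \<ge> 1 / 96 * norm (\<epsilon> ^ 74)"
      by (simp add: eventually_principal)
  qed simp
  show "(\<lambda>\<epsilon>::real. 17 * \<epsilon> powr (-1/2)) \<in> O[principal {0<..<1/2}](\<lambda>\<epsilon>. \<epsilon> powr (-1/2))"
    by simp
next
  fix \<epsilon> :: real assume \<epsilon>: "0 < \<epsilon> \<and> \<epsilon> < 1/2"
  then show "0 < \<epsilon> / 96" by simp
  have powr: "\<epsilon> powr (-1/2) = 1 / sqrt \<epsilon>"
    using \<epsilon> powr_minus_divide[of \<epsilon> "1 / 2"] by (simp add: powr_half_sqrt)
  have root: "1 \<le> 1 / sqrt \<epsilon>" using \<epsilon> by simp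
  then show "\<epsilon> / 96 < 17 * \<epsilon> powr (-1/2)" unfolding powr using \<epsilon> by linarith
  fix u l m n :: nat and S :: "bit vec set"
  assume "1 \<le> l \<and> l \<le> u \<and> 1 \<le> m \<and> n = 2 ^ l \<and> S \<subseteq> carrier_vec u \<and> card S = m \<and>
          real m \<ge> inverse (\<epsilon> / 96) * real n * log 2 (real n)"
  then have l: "1 \<le> l" and m: "1 \<le> m" "card S = m" and n: "n = 2 ^ l" and S: "S \<subseteq> carrier_vec u"
    and mn: "real m \<ge> inverse (\<epsilon> / 96) * real n * log 2 (real n)" by auto
  define q where "q = real m / 2 ^ l"
  \<comment> \<open>Since log n = l, the hypothesis on \<open>m\<close> says that \<open>l\<close>
    is at most \<epsilon>/96 times the average load \<open>q\<close>.\<close>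
  have q: "real l \<le> \<epsilon> / 96 * q" and q_pos: "q > 0"
    using mn \<epsilon> m(1) by (auto simp: q_def n log_nat_power field_simps)
  \<comment> \<open>The choice of 2^k between \<epsilon> q/48 and \<epsilon> q/24 makes the lower
    tail at most \<epsilon>/2, while 2^k - l still exceeds \<epsilon> q/96.\<close>
  have "1 \<le> \<epsilon> * q / 24" using q l by simp
  then obtain k where k: "2 ^ k \<le> \<epsilon> * q / 24" "\<epsilon> * q / 24 < 2 * 2 ^ k"
    using ex_power2_between by blast
  \<comment> \<open>R = 2 m / sqrt \<epsilon> makes the upper tail \<epsilon>/4, for a total of at
    most 3/4 \<epsilon>.\<close>
  have "1 - \<epsilon> \<le> 1 - 12 * 2 ^ (l + k) / real (card S) - (real (card S) / (2 * real m / sqrt \<epsilon>))\<^sup>2"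
  proof -
    have "12 * 2 ^ (l + k) / real (card S) = 12 * 2 ^ k / q"
      by (simp add: m q_def power_add)
    also have "\<dots> \<le> \<epsilon> / 2" using k(1) q_pos by (simp add: field_simps)
    finally have "12 * 2 ^ (l + k) / real (card S) \<le> \<epsilon> / 2" .
    moreover have "(real (card S) / (2 * real m / sqrt \<epsilon>))\<^sup>2 = \<epsilon> / 4"
      using m \<epsilon> by (simp add: power_divide)
    ultimately show ?thesis using \<epsilon> by simp
  qed
  also have "\<dots> \<le> measure_pmf.prob (pmf_of_set (linear_maps_F2 u l))
            {h. \<forall>y \<in> carrier_vec l. \<epsilon> / 96 * (real m / real n) \<le> real (card (h -` {y} \<inter> S)) \<and>
                  real (card (h -` {y} \<inter> S)) \<le> 17 * \<epsilon> powr (-1/2) * (real m / real n)}"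
  proof (rule prob_linear_map_loads[OF S])
    show "S \<noteq> {}" using m by auto
    show "2 * real m / sqrt \<epsilon> > 0" using m \<epsilon> by simp
    show "\<epsilon> / 96 * (real m / real n) \<le> real i" if "2 ^ k < i + l" for i
    proof -
      have "real (2 ^ k) < real (i + l)" using that by (simp only: of_nat_less_iff)
      then have "\<epsilon> / 48 * q < real i + real l" using k(2) by simp
      then show ?thesis using q by (simp add: n q_def)
    qed
    \<comment> \<open>The constant 17 is 8 * 2 from the upper tail plus 1 to absorb
      \<open>l\<close>.\<close>
    have "\<epsilon> / 96 \<le> 1 / sqrt \<epsilon>" using root \<epsilon> by linarith
    then have "\<epsilon> / 96 * q \<le> 1 / sqrt \<epsilon> * q" by (rule mult_right_mono) (use q_pos in simp)
    then have "real l + 16 * (1 / sqrt \<epsilon> * q) \<le> 17 * (1 / sqrt \<epsilon> * q)" using q by linarith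
    then show "real l + 8 * (2 * real m / sqrt \<epsilon>) / 2 ^ l \<le> 17 * \<epsilon> powr (-1/2) * (real m / real n)"
      unfolding powr n by (simp add: q_def mult_ac)
  qed
  finally show "1 - \<epsilon> \<le> measure_pmf.prob (pmf_of_set (linear_maps_F2 u l))
            {h. \<forall>y \<in> carrier_vec l. \<epsilon> / 96 * (real m / real n) \<le> real (card (h -` {y} \<inter> S)) \<and>
                  real (card (h -` {y} \<inter> S)) \<le> 17 * \<epsilon> powr (-1/2) * (real m / real n)}" .
qed

end
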